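(* Let $p \ge 5$ and $p \le q \le 2p$. Then $f(K(3,p,q)) = 2$.
   Context: $K(3,p,q)$ is the complete tripartite graph with parts of sizes $3$, $p$, $q$. A strong orientation of a graph is an orientation of all edges making the digraph strongly connected; the diameter of a strongly connected digraph is the maximum directed distance between ordered pairs of vertices. The oriented diameter $f(G)$ is the minimum diameter over all strong orientations of $G$. *)

theory Defs
  imports "Graph_Theory.Graph_Theory"
begin

text \<open>
  Following the AFP entry Graph Theory, an undirected simple graph is a symmetric loop-free
  digraph (locale \<^locale>\<open>pair_graph\<close>): the edge \<open>uv\<close> is the pair of arcs \<open>(u,v)\<close>, \<open>(v,u)\<close>.
\<close>

text \<open>The vertex \<open>(i, j)\<close> is the \<open>j\<close>-th vertex of the \<open>i\<close>-th part.\<close>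

definition tripartite_verts :: "nat \<Rightarrow> nat \<Rightarrow> nat \<Rightarrow> (nat \<times> nat) set" where
  "tripartite_verts a b c = {0} \<times> {..<a} \<union> {1} \<times> {..<b} \<union> {2} \<times> {..<c}"

definition complete_tripartite :: "nat \<Rightarrow> nat \<Rightarrow> nat \<Rightarrow> (nat \<times> nat) pair_pre_digraph" where
  "complete_tripartite a b c =
     \<lparr> pverts = tripartite_verts a b c,
       parcs = {(u, v). u \<in> tripartite_verts a b c \<and> v \<in> tripartite_verts a b c
                        \<and> fst u \<noteq> fst v} \<rparr>"

lemma pair_graph_complete_tripartite: "pair_graph (complete_tripartite a b c)"
proof -
  have "finite (tripartite_verts a b c)"
    by (simp add: tripartite_verts_def)
  then have "finite (parcs (complete_tripartite a b c))"
    by (rule_tac finite_subset[of _ "tripartite_verts a b c \<times> tripartite_verts a b c"])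
       (auto simp: complete_tripartite_def)
  with \<open>finite (tripartite_verts a b c)\<close> show ?thesis
    by unfold_locales
       (auto simp: complete_tripartite_def symmetric_def sym_def)
qed

definition orientation_of :: "'a pair_pre_digraph \<Rightarrow> 'a pair_pre_digraph \<Rightarrow> bool" where
  "orientation_of D G \<longleftrightarrow>
     pverts D = pverts G \<and>
     parcs D \<union> (parcs D)\<inverse> = parcs G \<and>
     parcs D \<inter> (parcs D)\<inverse> = {}"

lemma orientation_of_wf:
  assumes "pair_wf_digraph G" and "orientation_of D G"
  shows "pair_wf_digraph D"
proof -
  interpret pair_wf_digraph G by fact
  have "parcs D \<subseteq> parcs G" and "pverts D = pverts G"
    using assms(2) unfolding orientation_of_def by blast+
  then show ?thesis
    using arc_fst_in_verts arc_snd_in_verts by unfold_locales blast+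
qed

definition strong_orientation_of :: "'a pair_pre_digraph \<Rightarrow> 'a pair_pre_digraph \<Rightarrow> bool" where
  "strong_orientation_of D G \<longleftrightarrow> orientation_of D G \<and> strongly_connected (with_proj D)"

text \<open>
  The directed distance is the library's shortest-path weight for unit arc weights, i.e. the least
  number of arcs of a walk; it is \<open>\<infinity>\<close> if there is no walk.
\<close>

definition ddist :: "'a pair_pre_digraph \<Rightarrow> 'a \<Rightarrow> 'a \<Rightarrow> ereal" where
  "ddist D u v = wf_digraph.\<mu> (with_proj D) (\<lambda>_. 1) u v"

lemma ddist_eq_INF_length:
  assumes "pair_wf_digraph D"
  shows "ddist D u v =
    (INF w \<in> {w. pre_digraph.awalk (with_proj D) u w v}. ereal (real (length w)))"
proof -
  interpret pair_wf_digraph D by fact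
  have "awalk_cost (\<lambda>_. 1) w = real (length w)" for w
    by (induct w) (auto simp: awalk_cost_def)
  moreover have "wf_digraph (with_proj D)" by unfold_locales
  ultimately show ?thesis
    by (simp add: ddist_def wf_digraph.\<mu>_def)
qed

text \<open>
  For a strongly connected finite digraph the supremum ranges over a finite nonempty set of finite
  distances, so it is the maximum.
\<close>

definition diameter :: "'a pair_pre_digraph \<Rightarrow> ereal" where
  "diameter D = (SUP u \<in> pverts D. SUP v \<in> pverts D. ddist D u v)"

text \<open>
  A finite graph has only finitely many orientations, so the infimum is a minimum unless there is
  no strong orientation at all, in which case it is \<open>\<infinity>\<close>.
\<close>

definition oriented_diameter :: "'a pair_pre_digraph \<Rightarrow> ereal" where
  "oriented_diameter G = (INF D \<in> {D. strong_orientation_of D G}. diameter D)"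

end

theory Submission
  imports Defs
begin

text \<open>
  Let \<open>x\<^sub>i\<close>, \<open>v\<^sub>j\<close>, \<open>w\<^sub>k\<close> be the vertices of the parts of sizes \<open>3\<close>, \<open>p\<close>, \<open>q\<close>.
  Orient \<open>v\<^sub>0, v\<^sub>1\<close> towards \<open>x\<^sub>0\<close> only, and the remaining \<open>v\<^sub>j\<close> towards \<open>x\<^sub>1\<close> only.
  The out-neighbourhoods of the \<open>w\<^sub>k\<close> are \<open>{x\<^sub>1, x\<^sub>2, v\<^sub>k}\<close> for \<open>k < 2\<close>,
  \<open>{x\<^sub>0, x\<^sub>2, v\<^sub>k}\<close> for \<open>2 \<le> k < p\<close>, and \<open>{x\<^sub>2, v\<^sub>a, v\<^sub>b}\<close> for \<open>k \<ge> p\<close>, with pairwise different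
  pairs \<open>a < 2 \<le> b\<close>; there are \<open>2 (p - 2) \<ge> p\<close> such pairs. The first \<open>p\<close> vertices \<open>w\<^sub>k\<close> separate
  the \<open>v\<^sub>j\<close>, the out-neighbourhoods of the \<open>w\<^sub>k\<close> form an antichain, and every arc lies on a
  directed triangle, so all distances are at most \<open>2\<close>. Conversely, in any orientation
  the distance from the head of an arc back to its tail is at least \<open>2\<close>.
\<close>

lemma oriented_diameter_ge_2:
  assumes G: "pair_wf_digraph G" and e: "(u, v) \<in> parcs G"
  shows "2 \<le> oriented_diameter G"
  unfolding oriented_diameter_def
proof (rule INF_greatest)
  fix D assume "D \<in> {D. strong_orientation_of D G}"
  then have D: "orientation_of D G"
    by (simp add: strong_orientation_of_def)
  interpret D: pair_wf_digraph D
    using orientation_of_wf[OF G D] .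
  obtain a b where ab: "(a, b) \<in> parcs D" and ba: "(b, a) \<notin> parcs D"
    using D e unfolding orientation_of_def by blast
  have ne: "a \<noteq> b" using ab ba by blast
  have len: "2 \<le> length w" if "D.awalk b w a" for w
  proof (rule ccontr)
    assume "\<not> 2 \<le> length w"
    then have "w = [] \<or> (\<exists>x. w = [x])"
      by (cases w; cases "tl w") auto
    with that ne ba show False
      by (auto simp: D.awalk_simps)
  qed
  have "2 \<le> ddist D b a"
    unfolding ddist_eq_INF_length[OF D.pair_wf_digraph_axioms]
    by (rule INF_greatest) (use len in auto)
  also have "\<dots> \<le> (SUP v \<in> pverts D. ddist D b v)"
    using ab D.arc_fst_in_verts by (force intro: SUP_upper)
  also have "\<dots> \<le> diameter D"
    unfolding diameter_def using ab D.arc_snd_in_verts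
    by (force intro: SUP_upper2)
  finally show "2 \<le> diameter D" .
qed

text \<open>Walks of length at most 2 between all vertices give strong connectedness and the
  diameter bound together, which leaves only a check on the arcs of one orientation.\<close>

lemma oriented_diameter_le_2:
  assumes G: "pair_wf_digraph G" and D: "orientation_of D G" and ne: "pverts G \<noteq> {}"
    and two_steps: "\<And>u v. \<lbrakk>u \<in> pverts G; v \<in> pverts G; u \<noteq> v\<rbrakk> \<Longrightarrow>
      (u, v) \<in> parcs D \<or> (\<exists>z. (u, z) \<in> parcs D \<and> (z, v) \<in> parcs D)"
  shows "oriented_diameter G \<le> 2"
proof -
  interpret D: pair_wf_digraph D
    using orientation_of_wf[OF G D] .
  have verts: "pverts D = pverts G"
    using D by (simp add: orientation_of_def)
  have walk: "\<exists>w. D.awalk u w v \<and> length w \<le> 2"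
    if u: "u \<in> pverts D" and v: "v \<in> pverts D" for u v
  proof (cases "u = v")
    case True
    with u have "D.awalk u [] v" by (simp add: D.awalk_simps)
    then show ?thesis by force
  next
    case False
    then consider "(u, v) \<in> parcs D" | z where "(u, z) \<in> parcs D" "(z, v) \<in> parcs D"
      using two_steps u v verts by metis
    then show ?thesis
    proof cases
      case 1
      with u v have "D.awalk u [(u, v)] v" by (simp add: D.awalk_simps)
      then show ?thesis by force
    next
      case (2 z)
      with u v have "D.awalk u [(u, z), (z, v)] v"
        using D.arc_snd_in_verts by (force simp: D.awalk_simps)
      then show ?thesis by force
    qed
  qed
  have "strongly_connected (with_proj D)"
    using ne walk verts D.reachable_awalk unfolding strongly_connected_def by simp blast
  then have "strong_orientation_of D G"
    using D by (simp add: strong_orientation_of_def)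
  moreover have "diameter D \<le> 2"
    unfolding diameter_def
  proof (intro SUP_least)
    fix u v assume "u \<in> pverts D" "v \<in> pverts D"
    then obtain w where "D.awalk u w v" "length w \<le> 2"
      using walk by blast
    then show "ddist D u v \<le> 2"
      unfolding ddist_eq_INF_length[OF D.pair_wf_digraph_axioms]
      by (intro INF_lower2[of w]) auto
  qed
  ultimately show ?thesis
    unfolding oriented_diameter_def by (intro INF_lower2[of D]) auto
qed

definition v_to_x :: "nat \<Rightarrow> nat \<Rightarrow> bool" where
  "v_to_x j i \<longleftrightarrow> (if j < 2 then i = 0 else i = 1)"

text \<open>For \<open>k < p\<close>, among \<open>x\<^sub>0\<close>, \<open>x\<^sub>1\<close> the
  vertex \<open>w\<^sub>k\<close> points exactly to the one that \<open>v\<^sub>k\<close> does not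
  point to.\<close>

definition w_to_x :: "nat \<Rightarrow> nat \<Rightarrow> nat \<Rightarrow> bool" where
  "w_to_x p k i \<longleftrightarrow> i = 2 \<or> i = 1 \<and> k < 2 \<or> i = 0 \<and> 2 \<le> k \<and> k < p"

text \<open>The pairs \<open>{0, b}\<close> with \<open>2 \<le> b < p\<close> come first; then
  \<open>{1, 2}\<close> and \<open>{1, 3}\<close> suffice, since \<open>k < q \<le> 2 * p\<close>.
  The second index is given by an equation of sums, free of truncated subtraction.\<close>

definition w_to_v :: "nat \<Rightarrow> nat \<Rightarrow> nat \<Rightarrow> bool" where
  "w_to_v p k j \<longleftrightarrow>
     (if k < p then j = k
      else if k < 2 * p - 2 then j = 0 \<or> j + p = k + 2
      else j = 1 \<or> j + 2 * p = k + 4)"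

definition tri_arc :: "nat \<Rightarrow> nat \<times> nat \<Rightarrow> nat \<times> nat \<Rightarrow> bool" where
  "tri_arc p u v \<longleftrightarrow>
     fst u = 0 \<and> fst v = 1 \<and> \<not> v_to_x (snd v) (snd u) \<or>
     fst u = 1 \<and> fst v = 0 \<and> v_to_x (snd u) (snd v) \<or>
     fst u = 0 \<and> fst v = 2 \<and> \<not> w_to_x p (snd v) (snd u) \<or>
     fst u = 2 \<and> fst v = 0 \<and> w_to_x p (snd u) (snd v) \<or>
     fst u = 1 \<and> fst v = 2 \<and> \<not> w_to_v p (snd v) (snd u) \<or>
     fst u = 2 \<and> fst v = 1 \<and> w_to_v p (snd u) (snd v)"

definition tri_orientation :: "nat \<Rightarrow> nat \<Rightarrow> (nat \<times> nat) pair_pre_digraph" where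
  "tri_orientation p q =
     \<lparr> pverts = tripartite_verts 3 p q,
       parcs = {(u, v). u \<in> tripartite_verts 3 p q \<and> v \<in> tripartite_verts 3 p q \<and> tri_arc p u v} \<rparr>"

lemma mem_tripartite_verts:
  "(i, a) \<in> tripartite_verts l m n \<longleftrightarrow> i = 0 \<and> a < l \<or> i = 1 \<and> a < m \<or> i = 2 \<and> a < n"
  by (auto simp: tripartite_verts_def)

text \<open>Between two distinct parts, one direction is given by a predicate and the other by its
  negation.\<close>

lemma tri_arc_xor:
  assumes "u \<in> tripartite_verts a b c" and "v \<in> tripartite_verts a b c"
  shows "tri_arc p u v \<or> tri_arc p v u \<longleftrightarrow> fst u \<noteq> fst v" and "\<not> (tri_arc p u v \<and> tri_arc p v u)"
proof -
  have "fst u \<in> {0, 1, 2}" "fst v \<in> {0, 1, 2}"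
    using assms by (auto simp: tripartite_verts_def)
  then show "tri_arc p u v \<or> tri_arc p v u \<longleftrightarrow> fst u \<noteq> fst v" "\<not> (tri_arc p u v \<and> tri_arc p v u)"
    unfolding insert_iff empty_iff
    by - (elim disjE; simp add: tri_arc_def)+
qed

lemma tri_orientation_of: "orientation_of (tri_orientation p q) (complete_tripartite 3 p q)"
proof -
  let ?D = "tri_orientation p q" and ?G = "complete_tripartite 3 p q"
  have un: "(u, v) \<in> parcs ?D \<union> (parcs ?D)\<inverse> \<longleftrightarrow> (u, v) \<in> parcs ?G"
    and int: "(u, v) \<notin> parcs ?D \<inter> (parcs ?D)\<inverse>" for u v
    using tri_arc_xor[of u 3 p q v]
    by (simp_all add: tri_orientation_def complete_tripartite_def) blast+
  have "parcs ?D \<union> (parcs ?D)\<inverse> = parcs ?G"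
    by (intro equalityI subrelI) (simp_all only: un)
  moreover have "parcs ?D \<inter> (parcs ?D)\<inverse> = {}"
    using int by (metis equals0I surj_pair)
  moreover have "pverts ?D = pverts ?G"
    by (simp add: tri_orientation_def complete_tripartite_def)
  ultimately show ?thesis
    by (simp add: orientation_of_def)
qed

text \<open>The facts \<open>xx\<close>, \<open>xv\<close> and so on treat the ordered pairs of
  parts, source first. Where the direct arc is missing, a middle vertex is exhibited.\<close>

lemma tri_arc_two_steps:
  assumes p: "5 \<le> p" and pq: "p \<le> q" and q: "q \<le> 2 * p"
    and u: "u \<in> tripartite_verts 3 p q" and v: "v \<in> tripartite_verts 3 p q" and ne: "u \<noteq> v"
  shows "tri_arc p u v \<or> (\<exists>z \<in> tripartite_verts 3 p q. tri_arc p u z \<and> tri_arc p z v)"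
proof -
  let ?V = "tripartite_verts 3 p q"
  let ?c = "\<lambda>u v. tri_arc p u v \<or> (\<exists>z \<in> ?V. tri_arc p u z \<and> tri_arc p z v)"
  note defs = mem_tripartite_verts tri_arc_def v_to_x_def w_to_x_def w_to_v_def
  have via: "?c u v" if "z \<in> ?V" "tri_arc p u z" "tri_arc p z v" for u v z
    using that by blast
  have xx: "?c (0, i) (0, i')" if "i < 3" "i' < 3" "i \<noteq> i'" for i i'
  proof -
    \<comment> \<open>\<open>x\<^sub>0\<close> is reached through \<open>v\<^sub>0\<close> and
      \<open>x\<^sub>1\<close> through \<open>v\<^sub>2\<close>. Only the third part points to
      \<open>x\<^sub>2\<close>; there \<open>w\<^sub>0\<close> avoids \<open>x\<^sub>0\<close> and
      \<open>w\<^sub>2\<close> avoids \<open>x\<^sub>1\<close>.\<close>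
    have "i' = 0 \<or> i' = 1 \<or> i = 0 \<and> i' = 2 \<or> i = 1 \<and> i' = 2"
      using that by arith
    then consider "i' = 0" | "i' = 1" | "i = 0" "i' = 2" | "i = 1" "i' = 2"
      by blast
    then show ?thesis
    proof cases
      case 1 then show ?thesis using that p by (intro via[of "(1, 0)"]) (auto simp: defs)
    next
      case 2 then show ?thesis using that p by (intro via[of "(1, 2)"]) (auto simp: defs)
    next
      case 3 then show ?thesis using that p pq by (intro via[of "(2, 0)"]) (auto simp: defs)
    next
      case 4 then show ?thesis using that p pq by (intro via[of "(2, 2)"]) (auto simp: defs)
    qed
  qed
  have xv: "?c (0, i) (1, j)" if "i < 3" "j < p" for i j
  proof (cases "v_to_x j i")
    case True
    \<comment> \<open>\<open>w\<^sub>j\<close> points to \<open>v\<^sub>j\<close> but not to the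
      target \<open>x\<^sub>i\<close> of \<open>v\<^sub>j\<close>.\<close>
    then show ?thesis using that p pq by (intro via[of "(2, j)"]) (auto simp: defs split: if_splits)
  next
    case False
    then show ?thesis by (auto simp: tri_arc_def)
  qed
  have other: "\<exists>j'<p. j' \<noteq> j \<and> (j' < 2 \<longleftrightarrow> j < 2)" for j
  proof -
    consider "j = 0" | "j = 1" | "j = 2" | "j > 2" by linarith
    then show ?thesis
    proof cases
      case 1 then show ?thesis using p by (intro exI[of _ 1]) auto
    next
      case 2 then show ?thesis using p by (intro exI[of _ 0]) auto
    next
      case 3 then show ?thesis using p by (intro exI[of _ 3]) auto
    next
      case 4 then show ?thesis using p by (intro exI[of _ 2]) auto
    qed
  qed
  have vx: "?c (1, j) (0, i)" if "i < 3" "j < p" for i j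
  proof (cases "v_to_x j i")
    case False
    \<comment> \<open>Since \<open>j' \<noteq> j\<close>, there is an arc from \<open>(1, j)\<close>
      to \<open>(2, j')\<close>. As \<open>j'\<close> is on the same side of 2 as \<open>j\<close>,
      \<open>(2, j')\<close> points to both vertices of the first part that \<open>(1, j)\<close>
      does not point to.\<close>
    obtain j' where "j' < p" "j' \<noteq> j" "j' < 2 \<longleftrightarrow> j < 2" using other by blast
    then show ?thesis using that False p pq
      by (intro via[of "(2, j')"]) (auto simp: defs split: if_splits)
  next
    case True
    then show ?thesis by (auto simp: tri_arc_def)
  qed
  have vv: "?c (1, j) (1, j')" if "j < p" "j' < p" "j \<noteq> j'" for j j'
    using that pq by (intro via[of "(2, j')"]) (auto simp: defs)
  have wv: "?c (2, k) (1, j)" if "j < p" for j k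
  proof (cases "w_to_v p k j")
    case True
    then show ?thesis by (simp add: tri_arc_def)
  next
    case False
    with that show ?thesis
      \<comment> \<open>\<open>x\<^sub>2\<close> receives an arc from every \<open>w\<^sub>k\<close>
        and points to every \<open>v\<^sub>j\<close>.\<close>
      by (intro via[of "(0, 2)"]) (auto simp: tri_arc_def v_to_x_def w_to_x_def mem_tripartite_verts)
  qed
  have vw: "?c (1, j) (2, k)" if "j < p" "k < q" for j k
  proof (cases "w_to_v p k j")
    case True
    \<comment> \<open>The middle vertex is the target of \<open>v\<^sub>j\<close> in the first part.
      \<open>w\<^sub>k\<close> avoids it: if \<open>k < p\<close> by the complementary choice for
      \<open>j = k\<close>, otherwise because it points only to \<open>x\<^sub>2\<close> in that
      part.\<close>
    have "k < p \<Longrightarrow> j = k" using True by (auto simp: defs)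
    then have "\<not> w_to_x p k (if j < 2 then 0 else 1)"
      using that True p by (auto simp: defs)
    then show ?thesis using that by (intro via[of "(0, if j < 2 then 0 else 1)"])
        (auto simp: tri_arc_def v_to_x_def mem_tripartite_verts)
  next
    case False
    then show ?thesis by (auto simp: tri_arc_def)
  qed
  \<comment> \<open>For \<open>k < p\<close> take \<open>v\<^sub>k\<close>. For
    \<open>k \<ge> p\<close> the pair \<open>a < 2 \<le> b\<close> serves both targets:
    \<open>v\<^sub>a\<close> points to \<open>x\<^sub>0\<close> and \<open>v\<^sub>b\<close> to
    \<open>x\<^sub>1\<close>.\<close>
  have targets: "\<exists>j<p. w_to_v p k j \<and> v_to_x j i" if "k < q" "i < 2" "\<not> w_to_x p k i" for k i
  proof -
    have "i = 0 \<or> i = 1" using that by auto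
    then consider "k < p" | "p \<le> k" "i = 0" "k < 2 * p - 2" | "p \<le> k" "i = 0" "2 * p - 2 \<le> k"
      | "p \<le> k" "i = 1" "k < 2 * p - 2" | "p \<le> k" "i = 1" "2 * p - 2 \<le> k"
      by (metis not_le)
    then show ?thesis
    proof cases
      case 1 then show ?thesis using that by (intro exI[of _ k]) (auto simp: defs)
    next
      case 2 then show ?thesis using that p by (intro exI[of _ 0]) (auto simp: defs)
    next
      case 3 then show ?thesis using that p by (intro exI[of _ 1]) (auto simp: defs)
    next
      case 4 then show ?thesis using that p q by (intro exI[of _ "k + 2 - p"]) (auto simp: defs)
    next
      case 5 then show ?thesis using that p q by (intro exI[of _ "k + 4 - 2 * p"]) (auto simp: defs)
    qed
  qed
  have wx: "?c (2, k) (0, i)" if "k < q" "i < 3" for k i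
  proof (cases "w_to_x p k i")
    case False
    then have "i \<noteq> 2" by (simp add: w_to_x_def)
    with that have "i < 2" by linarith
    then obtain j where "j < p" "w_to_v p k j" "v_to_x j i"
      using targets[OF \<open>k < q\<close> _ False] by blast
    then show ?thesis
      by (intro via[of "(1, j)"]) (auto simp: tri_arc_def mem_tripartite_verts)
  next
    case True
    then show ?thesis by (auto simp: tri_arc_def)
  qed
  have xw: "?c (0, i) (2, k)" if "k < q" "i < 3" for k i
  proof (cases "w_to_x p k i")
    case True
    \<comment> \<open>For \<open>k < p\<close>, another index on the side of \<open>k\<close> works,
      as its vertex has the same target as \<open>v\<^sub>k\<close>. For \<open>k \<ge> p\<close>,
      the one of \<open>v\<^sub>0\<close>, \<open>v\<^sub>1\<close> outside the pair works.\<close>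
    have "\<exists>j<p. \<not> w_to_v p k j \<and> \<not> v_to_x j i"
    proof (cases "k < p")
      case kp: True
      obtain j where "j < p" "j \<noteq> k" "j < 2 \<longleftrightarrow> k < 2" using other by blast
      with True kp show ?thesis by (intro exI[of _ j]) (auto simp: defs)
    next
      case False
      with True have "i = 2" using p by (auto simp: defs)
      then show ?thesis using False p
        by (intro exI[of _ "if k < 2 * p - 2 then 1 else 0"]) (auto simp: defs)
    qed
    then obtain j where "j < p" "\<not> w_to_v p k j" "\<not> v_to_x j i" by blast
    then show ?thesis
      by (intro via[of "(1, j)"]) (auto simp: tri_arc_def mem_tripartite_verts)
  next
    case False
    then show ?thesis by (auto simp: tri_arc_def)
  qed
  have ww: "?c (2, k) (2, k')" if "k < q" "k' < q" "k \<noteq> k'" for k k'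
  proof (cases "\<exists>j<p. w_to_v p k j \<and> \<not> w_to_v p k' j")
    case True
    then obtain j where "j < p" "w_to_v p k j" "\<not> w_to_v p k' j" by blast
    then show ?thesis
      by (intro via[of "(1, j)"]) (auto simp: tri_arc_def mem_tripartite_verts)
  next
    case False
    then have sub: "w_to_v p k' j" if "j < p" "w_to_v p k j" for j using that by blast
    \<comment> \<open>If \<open>k \<ge> p\<close>, the inclusion \<open>sub\<close> gives
      \<open>(2, k')\<close> both out-neighbours \<open>a < 2 \<le> b\<close> of
      \<open>(2, k)\<close>. Different indices have different pairs, so \<open>k' = k\<close>, a
      contradiction.\<close>
    have kp: "k < p"
    proof (rule ccontr)
      assume "\<not> k < p"
      define a where "a = (if k < 2 * p - 2 then 0 else 1::nat)"
      define b where "b = (if k < 2 * p - 2 then k + 2 - p else k + 4 - 2 * p)"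
      have "w_to_v p k' a"
        using \<open>\<not> k < p\<close> p by (intro sub) (auto simp: a_def w_to_v_def)
      moreover have "w_to_v p k' b"
        using \<open>\<not> k < p\<close> p q that by (intro sub) (auto simp: b_def w_to_v_def)
      ultimately show False
        using \<open>\<not> k < p\<close> p q that by (auto simp: a_def b_def w_to_v_def split: if_splits)
    qed
    then have "w_to_v p k' k" by (intro sub) (auto simp: w_to_v_def)
    then have "\<not> k' < p" using that by (auto simp: w_to_v_def)
    \<comment> \<open>Now \<open>k < p \<le> k'\<close>: in the first part \<open>(2, k')\<close>
      points only to \<open>x\<^sub>2\<close>, while \<open>(2, k)\<close> also points to
      \<open>x\<^sub>1\<close> or \<open>x\<^sub>0\<close>.\<close>
    then show ?thesis using kp p
      by (intro via[of "(0, if k < 2 then 1 else 0)"]) (auto simp: defs)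
  qed
  obtain i a where ia: "u = (i, a)" by (cases u)
  obtain j b where jb: "v = (j, b)" by (cases v)
  have "?c (i, a) (j, b)"
    using u v ne unfolding ia jb mem_tripartite_verts
    by - (elim disjE conjE; hypsubst; rule xx xv xw vx vv vw wx wv ww; simp)
  then show ?thesis unfolding ia jb .
qed

theorem theorem5p9:
  fixes p q :: nat
  assumes "p \<ge> 5" and "p \<le> q" and "q \<le> 2 * p"
  shows "oriented_diameter (complete_tripartite 3 p q) = 2"
proof (rule antisym)
  have wf: "pair_wf_digraph (complete_tripartite 3 p q)"
    by unfold_locales (auto simp: complete_tripartite_def)
  have "((0, 0), (1, 0)) \<in> parcs (complete_tripartite 3 p q)"
    using assms by (simp add: complete_tripartite_def mem_tripartite_verts)
  then show "2 \<le> oriented_diameter (complete_tripartite 3 p q)"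
    by (rule oriented_diameter_ge_2[OF wf])
  show "oriented_diameter (complete_tripartite 3 p q) \<le> 2"
  proof (rule oriented_diameter_le_2[OF wf tri_orientation_of])
    have "(0, 0) \<in> pverts (complete_tripartite 3 p q)"
      by (simp add: complete_tripartite_def mem_tripartite_verts)
    then show "pverts (complete_tripartite 3 p q) \<noteq> {}" by blast
  next
    fix u v
    assume "u \<in> pverts (complete_tripartite 3 p q)" "v \<in> pverts (complete_tripartite 3 p q)"
      and ne: "u \<noteq> v"
    then have uv: "u \<in> tripartite_verts 3 p q" "v \<in> tripartite_verts 3 p q"
      by (simp_all add: complete_tripartite_def)
    show "(u, v) \<in> parcs (tri_orientation p q) \<or>
      (\<exists>z. (u, z) \<in> parcs (tri_orientation p q) \<and> (z, v) \<in> parcs (tri_orientation p q))"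
      using tri_arc_two_steps[OF assms uv ne] uv
      by (simp only: tri_orientation_def pair_pre_digraph.simps mem_Collect_eq case_prod_conv) blast
  qed
qed

end
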